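(* Let $X$ be a normed space, let $F\subseteq X$ be a nonempty closed convex set, and let $Q\subseteq X$ be a nonempty convex set. Suppose $\bar x\in Q-F_\infty$ and $0\in F$. Then $$\partial\mathcal{T}^F_Q(\bar x)=N(\bar x;Q-F_\infty)\cap C^*,\qquad\text{where } C^*=\{x^*\in X^*: \sigma_F(-x^* )\le 1\}.$$
   Context: Normed spaces are real; $X^*$ is the dual of $X$ and $\langle x^*,x\rangle=x^*(x)$. For $t\ge 0$, $tF=\{tf: f\in F\}$ (so $0F=\{0\}$), and $\inf\emptyset=\infty$. The minimal time function is $\mathcal{T}^F_Q(x)=\inf\{t\ge 0: (x+tF)\cap Q\ne\emptyset\}\in[0,\infty]$. The asymptotic cone of $F$ is $F_\infty=\{d\in X: x+td\in F \text{ for all } t>0\}$, where $x\in F$ is any point (the set does not depend on the choice of $x\in F$). $\sigma_F(x^* )=\sup\{\langle x^*,f\rangle: f\in F\}$. For a convex $\varphi:X\to(-\infty,\infty]$ and $\bar x$ with $\varphi(\bar x)<\infty$, $\partial\varphi(\bar x)=\{x^*\in X^*: \langle x^*,x-\bar x\rangle\le\varphi(x)-\varphi(\bar x)\text{ for all }x\in X\}$. For a convex set $A$ and $\bar x\in A$, $N(\bar x;A)=\{x^*\in X^*: \langle x^*,x-\bar x\rangle\le 0\text{ for all }x\in A\}$. *)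

theory Defs
  imports "HOL-Analysis.Analysis"
begin

text \<open>The dual space of \<open>'a\<close> is the type \<open>'a \<Rightarrow>\<^sub>L real\<close> of bounded linear functionals.\<close>

text \<open>In \<open>ereal\<close> the infimum of the empty set is \<open>\<infinity>\<close>.\<close>

definition minimal_time :: "'a::real_normed_vector set \<Rightarrow> 'a set \<Rightarrow> 'a \<Rightarrow> ereal" where
  "minimal_time F Q x =
     Inf {ereal t | t. t \<ge> 0 \<and> (+) x ` ((*\<^sub>R) t ` F) \<inter> Q \<noteq> {}}"

text \<open>For closed convex \<open>F\<close> the base point \<open>x \<in> F\<close> may be chosen arbitrarily; see
  \<open>asymptotic_cone_base_point\<close>.\<close>

definition asymptotic_cone :: "'a::real_normed_vector set \<Rightarrow> 'a set" where
  "asymptotic_cone F = {d. \<exists>x\<in>F. \<forall>t>0. x + t *\<^sub>R d \<in> F}"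

lemma asymptotic_cone_base_point:
  fixes F :: "'a::real_normed_vector set"
  assumes "closed F" "convex F" "y \<in> F"
  shows "asymptotic_cone F = {d. \<forall>t>0. y + t *\<^sub>R d \<in> F}"
proof -
  have "y + t *\<^sub>R d \<in> F" if x: "x \<in> F" "\<forall>t>0. x + t *\<^sub>R d \<in> F" and t: "t > 0" for x d and t :: real
  proof -
    define s :: "nat \<Rightarrow> real" where "s n = inverse (real (Suc n))" for n
    have s: "s n > 0" "s n \<le> 1" for n
      by (auto simp: s_def field_simps)
    have s0: "s \<longlonglongrightarrow> 0"
      unfolding s_def by (rule LIMSEQ_inverse_real_of_nat)
    have "(1 - s n) *\<^sub>R y + s n *\<^sub>R (x + (t / s n) *\<^sub>R d) \<in> F" for n
    proof (rule convexD[OF assms(2,3)])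
      have "t / s n > 0" using s[of n] t by simp
      then show "x + (t / s n) *\<^sub>R d \<in> F" using x by blast
    qed (use s[of n] in auto)
    moreover have "(1 - s n) *\<^sub>R y + s n *\<^sub>R (x + (t / s n) *\<^sub>R d)
        = (1 - s n) *\<^sub>R y + s n *\<^sub>R x + t *\<^sub>R d" for n
      using s[of n] by (simp add: scaleR_add_right)
    ultimately have "(1 - s n) *\<^sub>R y + s n *\<^sub>R x + t *\<^sub>R d \<in> F" for n
      by simp
    moreover have "(\<lambda>n. (1 - s n) *\<^sub>R y + s n *\<^sub>R x + t *\<^sub>R d)
        \<longlonglongrightarrow> (1 - 0) *\<^sub>R y + 0 *\<^sub>R x + t *\<^sub>R d"
      by (intro tendsto_intros s0)
    ultimately show ?thesis
      using closed_sequentially[OF assms(1)] by fastforce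
  qed
  then show ?thesis
    using assms(3) by (auto simp: asymptotic_cone_def)
qed

text \<open>The operation \<open>-\<close> on sets is set-theoretic difference, so the algebraic difference
  needs its own name.\<close>

definition minkowski_diff :: "'a::real_normed_vector set \<Rightarrow> 'a set \<Rightarrow> 'a set" where
  "minkowski_diff A B = {a - b | a b. a \<in> A \<and> b \<in> B}"

definition support_fun :: "'a::real_normed_vector set \<Rightarrow> ('a \<Rightarrow>\<^sub>L real) \<Rightarrow> ereal" where
  "support_fun F x' = (SUP f\<in>F. ereal (blinfun_apply x' f))"

text \<open>The subdifferential is only used for \<open>\<phi>\<close> with values in \<open>(-\<infinity>, \<infinity>]\<close>. The conditions
  \<open>\<phi> xbar < \<infinity>\<close> and \<open>xbar \<in> A\<close> below make the subdifferential and the normal cone empty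
  at points where they are otherwise undefined.\<close>

definition subdifferential ::
    "('a::real_normed_vector \<Rightarrow> ereal) \<Rightarrow> 'a \<Rightarrow> ('a \<Rightarrow>\<^sub>L real) set" where
  "subdifferential \<phi> xbar =
     {x'. \<phi> xbar < \<infinity> \<and> (\<forall>x. ereal (blinfun_apply x' (x - xbar)) \<le> \<phi> x - \<phi> xbar)}"

definition normal_cone ::
    "'a::real_normed_vector \<Rightarrow> 'a set \<Rightarrow> ('a \<Rightarrow>\<^sub>L real) set" where
  "normal_cone xbar A = {x'. xbar \<in> A \<and> (\<forall>x\<in>A. blinfun_apply x' (x - xbar) \<le> 0)}"

definition C_star :: "'a::real_normed_vector set \<Rightarrow> ('a \<Rightarrow>\<^sub>L real) set" where
  "C_star F = {x'. support_fun F (- x') \<le> 1}"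

end

theory Submission
  imports Defs
begin

text \<open>As \<open>0 \<in> F\<close>, every recession direction \<open>d\<close> can be followed at arbitrary speed inside
  \<open>F\<close>, so the minimal time vanishes on \<open>Q - F\<^sub>\<infinity>\<close>, and the subgradient inequality restricted to
  this set says that \<open>x'\<close> is normal to it. If \<open>xbar = q - d\<close> and \<open>f \<in> F\<close> then \<open>d + f \<in> F\<close>, so
  \<open>xbar - f\<close> reaches \<open>q\<close> in time 1; this gives \<open>\<langle>x', -f\<rangle> \<le> 1\<close>. Conversely, if \<open>x + t f = q \<in> Q\<close>,
  then \<open>\<langle>x', x - xbar\<rangle> = \<langle>x', q - xbar\<rangle> + t \<langle>x', -f\<rangle> \<le> t\<close>.\<close>

lemma minimal_time_le:
  assumes "t \<ge> 0" "f \<in> F" "x + t *\<^sub>R f \<in> Q"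
  shows "minimal_time F Q x \<le> ereal t"
  unfolding minimal_time_def using assms by (intro Inf_lower) auto

text \<open>Lower bounds become a pointwise condition, vacuous when \<open>Q\<close> is never
  reached and the infimum is \<infinity>.\<close>

lemma le_minimal_time_iff:
  "c \<le> minimal_time F Q x \<longleftrightarrow> (\<forall>t\<ge>0. \<forall>f\<in>F. x + t *\<^sub>R f \<in> Q \<longrightarrow> c \<le> ereal t)"
proof -
  have "(+) x ` ((*\<^sub>R) t ` F) \<inter> Q \<noteq> {} \<longleftrightarrow> (\<exists>f\<in>F. x + t *\<^sub>R f \<in> Q)" for t
    by blast
  then show ?thesis
    unfolding minimal_time_def le_Inf_iff by blast
qed

lemma minimal_time_eq_0:
  assumes "closed F" "convex F" "0 \<in> F" "x \<in> minkowski_diff Q (asymptotic_cone F)"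
  shows "minimal_time F Q x = 0"
proof (rule antisym)
  obtain q d where x: "x = q - d" "q \<in> Q" and d: "d \<in> asymptotic_cone F"
    using assms(4) by (auto simp: minkowski_diff_def)
  \<comment> \<open>Time 0 itself may fail, since \<open>x\<close> need not lie in \<open>Q\<close>;
    each \<open>t > 0\<close> works, with \<open>d / t\<close> as the point of
    \<open>F\<close>.\<close>
  have "minimal_time F Q x \<le> 0 + ereal t" if "t > 0" for t
  proof -
    have "(1 / t) *\<^sub>R d \<in> F"
      using d that asymptotic_cone_base_point[OF assms(1-3)] by simp
    moreover have "x + t *\<^sub>R ((1 / t) *\<^sub>R d) \<in> Q"
      using that x by simp
    ultimately show ?thesis
      using minimal_time_le[OF less_imp_le[OF that]] unfolding add_0 by blast
  qed
  then show "minimal_time F Q x \<le> 0"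
    by (simp add: ereal_le_epsilon2)
qed (simp add: le_minimal_time_iff)

lemma C_star_iff: "x' \<in> C_star F \<longleftrightarrow> (\<forall>f\<in>F. - blinfun_apply x' f \<le> 1)"
  by (simp add: C_star_def support_fun_def SUP_le_iff blinfun.minus_left one_ereal_def)

theorem theorem4p2:
  fixes F Q :: "'a::real_normed_vector set" and xbar :: 'a
  assumes "F \<noteq> {}" and "closed F" and "convex F"
    and "Q \<noteq> {}" and "convex Q"
    and "xbar \<in> minkowski_diff Q (asymptotic_cone F)"
    and "0 \<in> F"
  shows "subdifferential (minimal_time F Q) xbar =
    normal_cone xbar (minkowski_diff Q (asymptotic_cone F)) \<inter> C_star F"
proof -
  let ?D = "minkowski_diff Q (asymptotic_cone F)"
  have zero: "minimal_time F Q x = 0" if "x \<in> ?D" for x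
    using minimal_time_eq_0 assms that by blast
  \<comment> \<open>The value at \<open>xbar\<close> is 0, so finiteness and the
    \<open>ereal\<close> subtraction drop out.\<close>
  have sub: "x' \<in> subdifferential (minimal_time F Q) xbar \<longleftrightarrow>
      (\<forall>x. ereal (blinfun_apply x' (x - xbar)) \<le> minimal_time F Q x)" for x'
    by (simp add: subdifferential_def zero[OF assms(6)])
  show ?thesis
  proof (intro set_eqI iffI)
    fix x' assume "x' \<in> subdifferential (minimal_time F Q) xbar"
    then have le: "ereal (blinfun_apply x' (x - xbar)) \<le> minimal_time F Q x" for x
      using sub by blast
    have "blinfun_apply x' (x - xbar) \<le> 0" if "x \<in> ?D" for x
      using le[of x] zero[OF that] by simp
    then have "x' \<in> normal_cone xbar ?D"
      using assms(6) by (simp add: normal_cone_def)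
    moreover have "- blinfun_apply x' f \<le> 1" if "f \<in> F" for f
    proof -
      obtain q d where q: "xbar = q - d" "q \<in> Q" and d: "d \<in> asymptotic_cone F"
        using assms(6) by (auto simp: minkowski_diff_def)
      \<comment> \<open>Base the recession direction at \<open>f\<close> instead of 0.\<close>
      have "\<forall>t>0. f + t *\<^sub>R d \<in> F"
        using d asymptotic_cone_base_point[OF assms(2,3) \<open>f \<in> F\<close>] by simp
      from this[rule_format, of 1] have "f + d \<in> F"
        by simp
      then have "minimal_time F Q (xbar - f) \<le> ereal 1"
        using q by (intro minimal_time_le[of 1 "f + d"]) auto
      then have "ereal (blinfun_apply x' (xbar - f - xbar)) \<le> ereal 1"
        using le order_trans by blast
      then show ?thesis
        by (simp add: blinfun.minus_right)
    qed
    ultimately show "x' \<in> normal_cone xbar ?D \<inter> C_star F"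
      by (simp add: C_star_iff)
  next
    fix x' assume x': "x' \<in> normal_cone xbar ?D \<inter> C_star F"
    have "blinfun_apply x' (x - xbar) \<le> t"
      if "t \<ge> 0" "f \<in> F" "x + t *\<^sub>R f \<in> Q" for x t f
    proof -
      \<comment> \<open>This puts \<open>Q\<close> inside \<open>?D\<close>, so normality applies to
        the point of \<open>Q\<close> that is reached.\<close>
      have "0 \<in> asymptotic_cone F"
        using assms(7) by (auto simp: asymptotic_cone_def)
      then have "x + t *\<^sub>R f \<in> ?D"
        using that(3) by (force simp: minkowski_diff_def)
      then have "blinfun_apply x' (x + t *\<^sub>R f - xbar) \<le> 0"
        using x' by (simp add: normal_cone_def)
      moreover have "t * (- blinfun_apply x' f) \<le> t * 1"
        using x' that by (intro mult_left_mono) (auto simp: C_star_iff)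
      ultimately show ?thesis
        by (simp add: blinfun.diff_right blinfun.add_right blinfun.scaleR_right)
    qed
    then show "x' \<in> subdifferential (minimal_time F Q) xbar"
      by (simp add: sub le_minimal_time_iff)
  qed
qed

end
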